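(* Let $\bar X_B=(\bar R_B,\bar p_B)\in\mathrm{SO}(3)\times\mathbb R^3$ be a nominal pose and let $$\widehat J_{\rm MAP}(\bar X_B\oplus\xi)=\widehat J_{\rm MAP}(\bar X_B)+g^\top\xi+\tfrac12\xi^\top H\xi,\qquad \xi=[\phi^\top,v^\top]^\top\in\mathbb R^6,$$ be the local quadratic posterior model, with $g=[g_\phi^\top,g_v^\top]^\top\in\mathbb R^6$ and $H=\begin{bmatrix}H_{\phi\phi}&H_{\phi v}\\H_{v\phi}&H_{vv}\end{bmatrix}\in\mathbb R^{6\times6}$ symmetric, partitioned into $3\times3$ blocks. Assume $H_{vv}\succ0$ and define $$\Lambda_{\rm post}:=H_{vv},\qquad a_{\rm post}:=g_\phi-H_{\phi v}H_{vv}^{-1}g_v,\qquad M_{\rm post}:=H_{\phi\phi}-H_{\phi v}H_{vv}^{-1}H_{v\phi},\qquad C_{\rm post}:=\tfrac12\operatorname{tr}(M_{\rm post})I_3-M_{\rm post}.$$ Define further $$F_{\rm post}=\bar R_B\Bigl(C_{\rm post}-\tfrac12[a_{\rm post}]_\times\Bigr),$$ let $F_{\rm post}=U_{\rm post}S_{\rm post}V_{\rm post}^\top$ be a proper singular value decomposition, and let $\bar\nu_{\rm post}$ and $J_{\nu,\rm post}$ be the associated rotational coordinate and its Jacobian at $\bar R_B$ (see context). Assume that $M_{\rm post}\succeq0$, that $J_{\nu,\rm post}$ is nonsingular, and that the local right-perturbation chart at $\bar R_B$ is valid for the posterior mode perturbation (i.e. the rotation angle of $\bar R_B^\top U_{\rm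 post}V_{\rm post}^\top$ is less than $\pi$). Then: (a) $C_{\rm post}$ is the unique symmetric matrix with $\operatorname{tr}(C_{\rm post})I_3-C_{\rm post}=M_{\rm post}$, and $F_{\rm post}$ is the matrix Fisher parameter associated with the remaining rotational gradient and curvature, i.e. the function $\phi\mapsto-\operatorname{tr}\bigl(F_{\rm post}^\top\bar R_B\exp(\phi^\wedge)\bigr)$ has gradient $a_{\rm post}$ and Hessian $M_{\rm post}$ at $\phi=0$. (b) With $$\Gamma_{\rm post}=-H_{vv}^{-1}H_{v\phi}J_{\nu,\rm post}^{-1},\qquad \mu_{\rm post}=\bar p_B-H_{vv}^{-1}g_v-\Gamma_{\rm post}\bar\nu_{\rm post},$$ the coupled matrix Fisher--Gaussian distribution with parameters $\Theta_{\rm post}=(F_{\rm post},\mu_{\rm post},\Lambda_{\rm post},\Gamma_{\rm post})$ has a local energy expansion at $\bar X_B$ that matches the quadratic model in the prescribed first- and second-order information terms, i.e. its local first-order coefficient at $\bar X_B$ equals $g$ and its local (Gauss--Newton) second-order information matrix at $\bar X_B$ equals $H$.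
   Context: Right perturbation: $(R,p)\oplus[\phi^\top,v^\top]^\top:=(R\exp(\phi^\wedge),p+v)$ for $\phi,v\in\mathbb R^3$; $\phi^\wedge=[\phi]_\times$ is the skew matrix with $[\phi]_\times x=\phi\times x$, and $(\cdot)^\vee$ is the inverse of $(\cdot)^\wedge$. Proper singular value decomposition: $F=USV^\top$ with $U,V\in\mathrm{SO}(3)$ and $S=\operatorname{diag}(s_1,s_2,s_3)$, $s_1\ge s_2\ge|s_3|$. Given $F$ with a fixed proper SVD, the rotational coordinate is $\nu_R(R;F):=(QS-SQ^\top)^\vee$, $Q:=U^\top RV$. For $F_{\rm post}$: $\bar\nu_{\rm post}:=\nu_R(\bar R_B;F_{\rm post})$ and $J_{\nu,\rm post}:=\partial_\phi\,\nu_R(\bar R_B\exp(\phi^\wedge);F_{\rm post})|_{\phi=0}\in\mathbb R^{3\times3}$. Coupled matrix Fisher--Gaussian (MFG) distribution with parameters $\Theta=(F,\mu,\Lambda,\Gamma)$, $F,\Gamma\in\mathbb R^{3\times3}$, $\mu\in\mathbb R^3$, $\Lambda\succ0$: the density on $\mathrm{SO}(3)\times\mathbb R^3$ proportional to $\exp(-E_\Theta(R,p))$ with energy $$E_\Theta(R,p)=-\operatorname{tr}(F^\top R)+\tfrac12\bigl(p-\mu-\Gamma\nu_R(R;F)\bigr)^\top\Lambda\bigl(p-\mu-\Gamma\nu_R(R;F)\bigr).$$ Local information terms of an MFG energy at $\bar X_B$: the first-order coefficient is the gradient at $\xi=0$ of $\xi\mapsto E_\Theta(\bar X_B\oplus\xi)$.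 The (Gauss--Newton) second-order information matrix is the Hessian at $\xi=0$ of the function obtained from $E_\Theta(\bar X_B\oplus\xi)$ by keeping the matrix Fisher term $-\operatorname{tr}(F^\top\bar R_B\exp(\phi^\wedge))$ exactly and replacing $\nu_R(\bar R_B\exp(\phi^\wedge);F)$ in the quadratic term by its linearization $\nu_R(\bar R_B;F)+J_\nu\phi$, where $J_\nu=\partial_\phi\nu_R(\bar R_B\exp(\phi^\wedge);F)|_{\phi=0}$; that is, residual-weighted second derivatives of $\nu_R$ are omitted. *)

theory Defs
  imports "HOL-Analysis.Analysis"
begin

unbundle cross3_syntax

text \<open>Vectors of \<open>R\<^sup>6\<close> are indexed by the sum type \<open>3 + 3\<close>: the components \<open>Inl i\<close> form the rotational
  part \<open>\<phi>\<close>, the components \<open>Inr i\<close> the translational part \<open>v\<close>.  The \<open>3 \<times> 3\<close> blocks of a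
  \<open>6 \<times> 6\<close> matrix are selected accordingly, for instance \<open>H\<^sub>\<phi>\<^sub>v = block Inl Inr H\<close>.\<close>

definition rot_part :: "real^(3 + 3) \<Rightarrow> real^3" where
  "rot_part \<xi> = (\<chi> i. \<xi> $ Inl i)"

definition trans_part :: "real^(3 + 3) \<Rightarrow> real^3" where
  "trans_part \<xi> = (\<chi> i. \<xi> $ Inr i)"

definition block :: "(3 \<Rightarrow> 3 + 3) \<Rightarrow> (3 \<Rightarrow> 3 + 3) \<Rightarrow> real^(3 + 3)^(3 + 3) \<Rightarrow> real^3^3" where
  "block r c A = (\<chi> i j. A $ r i $ c j)"

definition symmetric_mat :: "real^'n^'n \<Rightarrow> bool" where
  "symmetric_mat A \<longleftrightarrow> transpose A = A"

definition pos_def :: "real^'n^'n \<Rightarrow> bool" where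
  "pos_def A \<longleftrightarrow> symmetric_mat A \<and> (\<forall>x. x \<noteq> 0 \<longrightarrow> x \<bullet> (A *v x) > 0)"

definition pos_semidef :: "real^'n^'n \<Rightarrow> bool" where
  "pos_semidef A \<longleftrightarrow> symmetric_mat A \<and> (\<forall>x. x \<bullet> (A *v x) \<ge> 0)"

text \<open>The Hessian is the Frechet derivative of the gradient, which has to exist near the point.\<close>

definition has_hessian :: "(real^'n \<Rightarrow> real) \<Rightarrow> real^'n^'n \<Rightarrow> real^'n \<Rightarrow> bool" where
  "has_hessian f H x \<longleftrightarrow>
     (\<exists>G. (\<forall>\<^sub>F y in nhds x. GDERIV f y :> G y) \<and> (G has_derivative (\<lambda>h. H *v h)) (at x))"

text \<open>The product \<open>*\<close> on \<open>real^3^3\<close> is componentwise, so the library function \<open>exp\<close> is not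
  applicable here.\<close>

definition matrix_exp :: "real^'n^'n \<Rightarrow> real^'n^'n" where
  "matrix_exp A = (\<Sum>n. (((**) A ^^ n) (mat 1)) /\<^sub>R fact n)"

definition hat :: "real^3 \<Rightarrow> real^3^3" where
  "hat \<phi> = matrix (\<lambda>x. \<phi> \<times> x)"

text \<open>The map \<open>hat\<close> is injective with the skew-symmetric matrices as its range; \<open>vee\<close> is only
  meaningful on these.\<close>

definition vee :: "real^3^3 \<Rightarrow> real^3" where
  "vee = inv hat"

text \<open>The angle in \<open>[0, \<pi>]\<close> of the rotation matrix \<open>Q\<close> about a suitable axis \<open>u\<close>.\<close>

definition rotation_angle :: "real^3^3 \<Rightarrow> real" where
  "rotation_angle Q =
     (THE \<theta>. 0 \<le> \<theta> \<and> \<theta> \<le> pi \<and> (\<exists>u. norm u = 1 \<and> Q = matrix_exp (\<theta> *\<^sub>R hat u)))"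

type_synonym pose = "(real^3^3) \<times> (real^3)"

definition right_perturb :: "pose \<Rightarrow> real^(3 + 3) \<Rightarrow> pose" (infixl \<open>\<boxplus>\<close> 65) where
  "X \<boxplus> \<xi> = (fst X ** matrix_exp (hat (rot_part \<xi>)), snd X + trans_part \<xi>)"

definition proper_svd :: "real^3^3 \<Rightarrow> real^3^3 \<Rightarrow> real^3^3 \<Rightarrow> real^3^3 \<Rightarrow> bool" where
  "proper_svd F U S V \<longleftrightarrow>
     rotation_matrix U \<and> rotation_matrix V \<and> F = U ** S ** transpose V \<and>
     (\<forall>i j. i \<noteq> j \<longrightarrow> S $ i $ j = 0) \<and>
     S $ 1 $ 1 \<ge> S $ 2 $ 2 \<and> S $ 2 $ 2 \<ge> \<bar>S $ 3 $ 3\<bar>"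

text \<open>The rotational coordinate depends on \<open>F\<close> through its fixed proper singular value
  decomposition only, so it takes the factors as arguments.\<close>

definition rot_coord :: "real^3^3 \<Rightarrow> real^3^3 \<Rightarrow> real^3^3 \<Rightarrow> real^3^3 \<Rightarrow> real^3" where
  "rot_coord U S V R =
     (let Q = transpose U ** R ** V in vee (Q ** S - S ** transpose Q))"

definition rot_coord_jacobian :: "real^3^3 \<Rightarrow> real^3^3 \<Rightarrow> real^3^3 \<Rightarrow> real^3^3 \<Rightarrow> real^3^3" where
  "rot_coord_jacobian U S V R =
     jacobian (\<lambda>\<phi>. rot_coord U S V (R ** matrix_exp (hat \<phi>))) (at 0)"

text \<open>Parameters of a matrix Fisher--Gaussian distribution, together with the fixed proper singular
  value decomposition of \<open>F\<close>.\<close>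

record mfg =
  mfg_F :: "real^3^3"
  mfg_U :: "real^3^3"
  mfg_S :: "real^3^3"
  mfg_V :: "real^3^3"
  mfg_mu :: "real^3"
  mfg_Lambda :: "real^3^3"
  mfg_Gamma :: "real^3^3"

definition mfg_valid :: "mfg \<Rightarrow> bool" where
  "mfg_valid \<Theta> \<longleftrightarrow>
     proper_svd (mfg_F \<Theta>) (mfg_U \<Theta>) (mfg_S \<Theta>) (mfg_V \<Theta>) \<and> pos_def (mfg_Lambda \<Theta>)"

definition mfg_nu :: "mfg \<Rightarrow> real^3^3 \<Rightarrow> real^3" where
  "mfg_nu \<Theta> = rot_coord (mfg_U \<Theta>) (mfg_S \<Theta>) (mfg_V \<Theta>)"

text \<open>The matrix Fisher energy.\<close>

definition fisher_energy :: "real^3^3 \<Rightarrow> real^3^3 \<Rightarrow> real" where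
  "fisher_energy F R = - trace (transpose F ** R)"

text \<open>The coupled quadratic energy, with the value \<open>\<nu>\<close> of the rotational coordinate as an argument:
  the energy itself and its Gauss--Newton approximation differ only in this argument.\<close>

definition mfg_quadratic :: "mfg \<Rightarrow> real^3 \<Rightarrow> real^3 \<Rightarrow> real" where
  "mfg_quadratic \<Theta> \<nu> p =
     (let r = p - mfg_mu \<Theta> - mfg_Gamma \<Theta> *v \<nu> in (1/2) * (r \<bullet> (mfg_Lambda \<Theta> *v r)))"

definition mfg_energy :: "mfg \<Rightarrow> pose \<Rightarrow> real" where
  "mfg_energy \<Theta> X =
     fisher_energy (mfg_F \<Theta>) (fst X) + mfg_quadratic \<Theta> (mfg_nu \<Theta> (fst X)) (snd X)"

definition mfg_energy_GN :: "mfg \<Rightarrow> pose \<Rightarrow> real^(3 + 3) \<Rightarrow> real" where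
  "mfg_energy_GN \<Theta> X \<xi> =
     fisher_energy (mfg_F \<Theta>) (fst (X \<boxplus> \<xi>)) +
     mfg_quadratic \<Theta>
       (mfg_nu \<Theta> (fst X)
          + rot_coord_jacobian (mfg_U \<Theta>) (mfg_S \<Theta>) (mfg_V \<Theta>) (fst X) *v rot_part \<xi>)
       (snd (X \<boxplus> \<xi>))"

definition local_first_order :: "mfg \<Rightarrow> pose \<Rightarrow> real^(3 + 3) \<Rightarrow> bool" where
  "local_first_order \<Theta> X g \<longleftrightarrow> GDERIV (\<lambda>\<xi>. mfg_energy \<Theta> (X \<boxplus> \<xi>)) 0 :> g"

definition local_second_order_GN :: "mfg \<Rightarrow> pose \<Rightarrow> real^(3 + 3)^(3 + 3) \<Rightarrow> bool" where
  "local_second_order_GN \<Theta> X H \<longleftrightarrow> has_hessian (mfg_energy_GN \<Theta> X) H 0"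

end

theory Submission
  imports Defs
begin

text \<open>By Rodrigues' formula \<open>exp (\<phi>\<^sup>\<and>) = I + \<alpha>(\<phi> \<bullet> \<phi>) \<phi>\<^sup>\<and> + \<beta>(\<phi> \<bullet> \<phi>) (\<phi>\<^sup>\<and>)\<^sup>2\<close> with entire functions
  \<open>\<alpha>\<close>, \<open>\<beta>\<close>, \<open>\<alpha>(0) = 1\<close>, \<open>\<beta>(0) = 1/2\<close>, the matrix Fisher energy equals
  \<open>- tr C + \<alpha>(\<phi> \<bullet> \<phi>) a \<bullet> \<phi> + \<beta>(\<phi> \<bullet> \<phi>) \<phi> \<bullet> M \<phi>\<close>, because \<open>\<phi>\<^sup>\<and>\<close> is skew and
  \<open>(\<phi>\<^sup>\<and>)\<^sup>2 = \<phi> \<phi>\<^sup>T - (\<phi> \<bullet> \<phi>) I\<close>.  The residual of the coupled quadratic term has the value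
  \<open>H\<^sub>v\<^sub>v\<^sup>-\<^sup>1 g\<^sub>v\<close> and, since \<open>\<Gamma> J\<^sub>\<nu> = - H\<^sub>v\<^sub>v\<^sup>-\<^sup>1 H\<^sub>v\<^sub>\<phi>\<close>, the derivative \<open>v + H\<^sub>v\<^sub>v\<^sup>-\<^sup>1 H\<^sub>v\<^sub>\<phi> \<phi>\<close> at the
  nominal pose, so this term contributes exactly what the Schur complement removed from \<open>g\<close> and
  \<open>H\<close>.\<close>

text \<open>With \<open>s = \<theta>\<^sup>2\<close> the cases \<open>m = 1, 2\<close> are the power series of \<open>sin \<theta> / \<theta>\<close> and \<open>(1 - cos \<theta>) / \<theta>\<^sup>2\<close>;
  as functions of \<open>s\<close> they are smooth at \<open>0\<close>, unlike the closed forms.\<close>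

definition rodrigues_coeff :: "nat \<Rightarrow> nat \<Rightarrow> real" where
  "rodrigues_coeff m n = (-1) ^ n / fact (2 * n + m)"

definition rodrigues :: "nat \<Rightarrow> real \<Rightarrow> real" where
  "rodrigues m s = (\<Sum>n. rodrigues_coeff m n * s ^ n)"

definition rodrigues' :: "nat \<Rightarrow> real \<Rightarrow> real" where
  "rodrigues' m s = (\<Sum>n. diffs (rodrigues_coeff m) n * s ^ n)"

lemma summable_rodrigues: "summable (\<lambda>n. rodrigues_coeff m n * s ^ n)"
proof (rule summable_comparison_test')
  show "summable (\<lambda>n. \<bar>s\<bar> ^ n / fact n)"
    using summable_exp[of "\<bar>s\<bar>"] by (simp add: field_simps)
  show "norm (rodrigues_coeff m n * s ^ n) \<le> \<bar>s\<bar> ^ n / fact n" if "n \<ge> 0" for n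
  proof -
    have "(fact n :: real) \<le> fact (2 * n + m)"
      by (rule fact_mono) simp
    then show ?thesis
      by (simp add: rodrigues_coeff_def abs_mult power_abs frac_le)
  qed
qed

lemma DERIV_rodrigues: "(rodrigues m has_real_derivative rodrigues' m s) (at s)"
  unfolding rodrigues_def[abs_def] rodrigues'_def
  by (rule termdiffs_strong_converges_everywhere[OF summable_rodrigues])

lemma rodrigues'_differentiable: "\<exists>d. (rodrigues' m has_real_derivative d) (at s)"
  unfolding rodrigues'_def[abs_def]
  by (rule exI, rule termdiffs_strong_converges_everywhere,
      rule termdiff_converges_all[OF summable_rodrigues])

lemma rodrigues_0 [simp]: "rodrigues m 0 = 1 / fact m"
  using powser_zero[of "rodrigues_coeff m"] by (simp add: rodrigues_def rodrigues_coeff_def)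

lemma hat_entries:
  "hat x = vector [vector [0, - x$3, x$2], vector [x$3, 0, - x$1], vector [- x$2, x$1, 0]]"
  by (simp add: hat_def matrix_def cross3_def vec_eq_iff forall_3 axis_def)

lemma linear_hat: "linear hat"
  by (rule linearI) (simp_all add: hat_entries vec_eq_iff forall_3)

lemma hat_0 [simp]: "hat 0 = 0"
  using linear_hat by (rule linear_0)

lemma linear_transpose: "linear (transpose :: real^'n^'m \<Rightarrow> real^'m^'n)"
  by (rule linearI) (simp_all add: transpose_def vec_eq_iff)

lemma linear_matrix_mult_left: "linear (\<lambda>X. A ** X :: real^'n^'m)"
  by (rule linearI) (simp_all add: matrix_matrix_mult_def vec_eq_iff sum.distrib sum_distrib_left algebra_simps)

lemma linear_matrix_mult_right: "linear (\<lambda>X. X ** A :: real^'n^'m)"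
  by (rule linearI) (simp_all add: matrix_matrix_mult_def vec_eq_iff sum.distrib sum_distrib_left algebra_simps)

lemma bounded_bilinear_matrix_mult:
  "bounded_bilinear (\<lambda>(A :: real^'n^'m) (B :: real^'k^'n). A ** B)"
  by (simp add: bilinear_conv_bounded_bilinear[symmetric] bilinear_def
      linear_matrix_mult_left linear_matrix_mult_right)

lemma hat_square:
  "hat x ** hat x = vector [vector [- (x$2)\<^sup>2 - (x$3)\<^sup>2, x$1 * x$2, x$1 * x$3],
     vector [x$1 * x$2, - (x$1)\<^sup>2 - (x$3)\<^sup>2, x$2 * x$3],
     vector [x$1 * x$3, x$2 * x$3, - (x$1)\<^sup>2 - (x$2)\<^sup>2]]"
  by (simp add: matrix_matrix_mult_def hat_entries vec_eq_iff forall_3 sum_3 power2_eq_square)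

lemma hat_cube: "hat x ** (hat x ** hat x) = - (x \<bullet> x) *\<^sub>R hat x"
  unfolding hat_square
  by (simp add: matrix_matrix_mult_def hat_entries vec_eq_iff forall_3 sum_3 inner_vec_def
      power2_eq_square algebra_simps)

lemma hat_power_odd: "((**) (hat x) ^^ (2 * n + 1)) (mat 1) = (- (x \<bullet> x)) ^ n *\<^sub>R hat x"
proof (induction n)
  case (Suc n)
  have "((**) (hat x) ^^ (2 * Suc n + 1)) (mat 1)
      = hat x ** (hat x ** ((**) (hat x) ^^ (2 * n + 1)) (mat 1))"
    by simp
  also have "\<dots> = (- (x \<bullet> x)) ^ n *\<^sub>R (hat x ** (hat x ** hat x))"
    unfolding Suc by (simp add: linear_cmul[OF linear_matrix_mult_left])
  finally show ?case by (simp add: hat_cube)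
qed simp

lemma hat_power_even: "((**) (hat x) ^^ (2 * n + 2)) (mat 1) = (- (x \<bullet> x)) ^ n *\<^sub>R (hat x ** hat x)"
proof -
  have "((**) (hat x) ^^ (2 * n + 2)) (mat 1) = hat x ** ((**) (hat x) ^^ (2 * n + 1)) (mat 1)"
    by simp
  then show ?thesis
    unfolding hat_power_odd by (simp add: linear_cmul[OF linear_matrix_mult_left])
qed

lemma rodrigues_sums:
  "(\<lambda>k. if \<exists>n. k = 2 * n + m then (- s) ^ ((k - m) div 2) / fact k else 0) sums rodrigues m s"
  (is "?f sums _")
proof -
  have "(\<lambda>n. ?f (2 * n + m)) sums rodrigues m s"
    using summable_sums[OF summable_rodrigues[of m s]]
    by (simp add: rodrigues_def rodrigues_coeff_def power_minus[of s])
  moreover have "strict_mono (\<lambda>n. 2 * n + m)"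
    by (simp add: strict_mono_def)
  ultimately show ?thesis
    by (subst (asm) sums_mono_reindex) auto
qed

lemma matrix_exp_hat:
  "matrix_exp (hat x) = mat 1 + rodrigues 1 (x \<bullet> x) *\<^sub>R hat x
     + rodrigues 2 (x \<bullet> x) *\<^sub>R (hat x ** hat x)"
proof -
  let ?c = "\<lambda>m k. if \<exists>n. k = 2 * n + m then (- (x \<bullet> x)) ^ ((k - m) div 2) / fact k else 0"
  let ?g = "\<lambda>k. (if k = 0 then mat 1 else 0) + ?c 1 k *\<^sub>R hat x + ?c 2 k *\<^sub>R (hat x ** hat x)"
  have "?g sums (mat 1 + rodrigues 1 (x \<bullet> x) *\<^sub>R hat x + rodrigues 2 (x \<bullet> x) *\<^sub>R (hat x ** hat x))"
    by (intro sums_add bounded_linear.sums[OF bounded_linear_scaleR_left] rodrigues_sums sums_single)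
  moreover have "?g k = (((**) (hat x) ^^ k) (mat 1)) /\<^sub>R fact k" for k
  proof -
    have "k = 0 \<or> (\<exists>n. k = 2 * n + 1) \<or> (\<exists>n. k = 2 * n + 2)"
      by presburger
    then consider "k = 0" | n where "k = 2 * n + 1" | n where "k = 2 * n + 2"
      by blast
    then show ?thesis
    proof cases
      case 2
      moreover have "\<not> (\<exists>n'. k = 2 * n' + 2)"
        using 2 by presburger
      ultimately show ?thesis
        by (simp only: hat_power_odd) (auto simp: divide_inverse mult.commute)
    next
      case 3
      moreover have "\<not> (\<exists>n'. k = 2 * n' + 1)"
        using 3 by presburger
      ultimately show ?thesis
        by (simp only: hat_power_even) (auto simp: divide_inverse mult.commute)
    qed simp
  qed
  ultimately show ?thesis
    unfolding matrix_exp_def by (simp only: sums_iff)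
qed

lemma matrix_exp_0: "matrix_exp 0 = (mat 1 :: real^3^3)"
  using matrix_exp_hat[of 0] by (simp add: linear_0[OF linear_matrix_mult_left])

lemma has_derivative_inner_self: "((\<lambda>x. x \<bullet> x) has_derivative (\<lambda>h. 2 * (x \<bullet> h))) (at x)"
  by (auto intro!: derivative_eq_intros simp: inner_commute)

lemma has_derivative_rodrigues_inner:
  "((\<lambda>x. rodrigues m (x \<bullet> x)) has_derivative (\<lambda>h. rodrigues' m (x \<bullet> x) * (2 * (x \<bullet> h)))) (at x)"
  using has_derivative_compose[OF has_derivative_inner_self
      DERIV_rodrigues[unfolded has_field_derivative_def]] .

lemma matrix_exp_hat_differentiable: "(\<lambda>x. matrix_exp (hat x)) differentiable at x"
proof -
  have h: "(hat has_derivative hat) (at x)"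
    by (simp add: linear_imp_has_derivative linear_hat)
  show ?thesis
    unfolding matrix_exp_hat differentiable_def
    by (rule exI) (rule derivative_intros has_derivative_rodrigues_inner h
        bounded_bilinear.FDERIV[OF bounded_bilinear_matrix_mult])+
qed

lemma fisher_energy_rodrigues:
  assumes R: "orthogonal_matrix R" and C: "symmetric_mat C"
    and F: "F = R ** (C - (1/2) *\<^sub>R hat a)"
  shows "fisher_energy F (R ** matrix_exp (hat x))
    = - trace C + rodrigues 1 (x \<bullet> x) * (a \<bullet> x)
      + rodrigues 2 (x \<bullet> x) * (x \<bullet> ((mat (trace C) - C) *v x))"
proof -
  define A where "A = transpose (C - (1/2) *\<^sub>R hat a)"
  have "C$j$i = C$i$j" for i j
    using arg_cong[OF C[unfolded symmetric_mat_def], of "\<lambda>B. B$i$j"] by (simp add: transpose_def)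
  note C' = this[of 1 2] this[of 1 3] this[of 2 3]
  have A: "A = C + (1/2) *\<^sub>R hat a"
    unfolding A_def by (simp add: transpose_def hat_entries vec_eq_iff forall_3 C')
  have "transpose F ** (R ** X) = A ** X" for X :: "real^3^3"
  proof -
    have "transpose F ** (R ** X) = A ** ((transpose R ** R) ** X)"
      by (simp add: F A_def matrix_transpose_mul matrix_mul_assoc)
    then show ?thesis
      using R by (simp add: orthogonal_matrix_def)
  qed
  then have "fisher_energy F (R ** matrix_exp (hat x)) = - trace (A ** matrix_exp (hat x))"
    by (simp only: fisher_energy_def)
  also have "\<dots> = - trace A - rodrigues 1 (x \<bullet> x) * trace (A ** hat x)
      - rodrigues 2 (x \<bullet> x) * trace (A ** (hat x ** hat x))"
    unfolding matrix_exp_hat matrix_add_ldistrib linear_cmul[OF linear_matrix_mult_left] trace_add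
    by (simp add: trace_def sum_distrib_left)
  finally have "fisher_energy F (R ** matrix_exp (hat x)) = - trace A
      - rodrigues 1 (x \<bullet> x) * trace (A ** hat x)
      - rodrigues 2 (x \<bullet> x) * trace (A ** (hat x ** hat x))" .
  moreover have "trace A = trace C" "trace (A ** hat x) = - (a \<bullet> x)"
    unfolding A
    by (simp_all add: trace_def sum_3 matrix_matrix_mult_def hat_entries C' inner_vec_def
        algebra_simps)
  moreover have "trace (A ** (hat x ** hat x)) = - (x \<bullet> ((mat (trace C) - C) *v x))"
    unfolding A hat_square
    by (simp add: trace_def sum_3 matrix_matrix_mult_def matrix_vector_mult_def mat_def hat_entries C'
        inner_vec_def power2_eq_square algebra_simps)
  ultimately show ?thesis by simp
qed

lemma has_derivative_matrix_vector_mult: "((*v) (A :: real^'n^'m) has_derivative (*v) A) (at x within X)"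
  by (rule bounded_linear_imp_has_derivative) simp

lemma gderiv_quadratic_form:
  fixes r :: "real^'n \<Rightarrow> real^'m"
  assumes r: "(r has_derivative (*v) B) (at x)" and A: "symmetric_mat A"
  shows "GDERIV (\<lambda>x. (1/2) * (r x \<bullet> (A *v r x))) x :> transpose B *v (A *v r x)"
proof -
  note [derivative_intros] = has_derivative_compose[OF r has_derivative_matrix_vector_mult]
  have A': "u \<bullet> (A *v v) = (A *v u) \<bullet> v" for u v
    using A unfolding symmetric_mat_def by (metis dot_lmul_matrix transpose_matrix_vector)
  have "((\<lambda>x. (1/2) * (r x \<bullet> (A *v r x))) has_derivative
      (\<lambda>h. (1/2) * (r x \<bullet> (A *v (B *v h)) + (B *v h) \<bullet> (A *v r x)))) (at x)"
    by (rule derivative_intros r)+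
  moreover have "(B *v h) \<bullet> (A *v r x) = h \<bullet> (transpose B *v (A *v r x))" for h
    by (metis dot_lmul_matrix inner_commute transpose_matrix_vector transpose_transpose)
  moreover have "r x \<bullet> (A *v (B *v h)) = (B *v h) \<bullet> (A *v r x)" for h
    using A' inner_commute by metis
  ultimately show ?thesis by (simp add: gderiv_def)
qed

lemma has_hessian_quadratic_form:
  assumes r: "\<And>x. (r has_derivative (*v) B) (at x)" and A: "symmetric_mat A"
  shows "has_hessian (\<lambda>x. (1/2) * (r x \<bullet> (A *v r x))) (transpose B ** A ** B) x"
  unfolding has_hessian_def
proof (intro exI conjI)
  show "\<forall>\<^sub>F y in nhds x. GDERIV (\<lambda>x. (1/2) * (r x \<bullet> (A *v r x))) y :> transpose B *v (A *v r y)"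
    using gderiv_quadratic_form[OF r A] by simp
  have "((\<lambda>y. transpose B *v (A *v r y)) has_derivative (\<lambda>h. transpose B *v (A *v (B *v h)))) (at x)"
    by (intro has_derivative_compose[OF _ has_derivative_matrix_vector_mult] r)
  then show "((\<lambda>y. transpose B *v (A *v r y)) has_derivative (*v) (transpose B ** A ** B)) (at x)"
    by (simp add: matrix_vector_mul_assoc matrix_mul_assoc)
qed

lemma gderiv_compose_matrix:
  fixes P :: "real^'n^'m"
  assumes "GDERIV f (P *v x) :> d"
  shows "GDERIV (\<lambda>x. f (P *v x)) x :> transpose P *v d"
proof -
  have "((\<lambda>x. f (P *v x)) has_derivative (\<lambda>h. (P *v h) \<bullet> d)) (at x)"
    using has_derivative_compose[where f = "(*v) P" and g = f,
        OF has_derivative_matrix_vector_mult assms[unfolded gderiv_def]] .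
  moreover have "(P *v h) \<bullet> d = h \<bullet> (transpose P *v d)" for h
    by (metis dot_lmul_matrix inner_commute transpose_matrix_vector transpose_transpose)
  ultimately show ?thesis by (simp add: gderiv_def)
qed

lemma has_hessian_compose_matrix:
  assumes "has_hessian f A (P *v x)"
  shows "has_hessian (\<lambda>x. f (P *v x)) (transpose P ** A ** P) x"
proof -
  obtain G where G: "\<forall>\<^sub>F y in nhds (P *v x). GDERIV f y :> G y" "(G has_derivative (*v) A) (at (P *v x))"
    using assms unfolding has_hessian_def by blast
  have "filterlim ((*v) P) (nhds (P *v x)) (nhds x)"
    using matrix_vector_mult_linear_continuous_at[of x P]
    by (simp add: isCont_def flip: tendsto_at_iff_tendsto_nhds)
  then have "\<forall>\<^sub>F y in nhds x. GDERIV f (P *v y) :> G (P *v y)"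
    using G(1) filterlim_iff by blast
  then have "\<forall>\<^sub>F y in nhds x. GDERIV (\<lambda>x. f (P *v x)) y :> transpose P *v G (P *v y)"
    by (rule eventually_mono) (rule gderiv_compose_matrix)
  moreover have "((\<lambda>y. transpose P *v G (P *v y)) has_derivative (\<lambda>h. transpose P *v (A *v (P *v h)))) (at x)"
    by (intro has_derivative_compose[OF _ has_derivative_matrix_vector_mult]
        has_derivative_compose[where f = "(*v) P" and g = G] has_derivative_matrix_vector_mult G(2))
  ultimately show ?thesis
    unfolding has_hessian_def by (auto simp: matrix_vector_mul_assoc matrix_mul_assoc)
qed

lemma has_hessian_add:
  assumes "has_hessian f A x" "has_hessian g B x"
  shows "has_hessian (\<lambda>x. f x + g x) (A + B) x"
proof -
  obtain G K where "\<forall>\<^sub>F y in nhds x. GDERIV f y :> G y" "(G has_derivative (*v) A) (at x)"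
    and "\<forall>\<^sub>F y in nhds x. GDERIV g y :> K y" "(K has_derivative (*v) B) (at x)"
    using assms unfolding has_hessian_def by blast
  then have "\<forall>\<^sub>F y in nhds x. GDERIV (\<lambda>x. f x + g x) y :> G y + K y"
    and "((\<lambda>x. G x + K x) has_derivative (\<lambda>h. A *v h + B *v h)) (at x)"
    by (auto elim: eventually_elim2 intro: GDERIV_add has_derivative_add)
  moreover have "(*v) (A + B) = (\<lambda>h. A *v h + B *v h)"
    by (simp add: fun_eq_iff matrix_vector_mult_add_rdistrib)
  ultimately show ?thesis unfolding has_hessian_def by auto
qed

lemma rodrigues_quadratic_expansion:
  fixes a :: "real^'n" and c :: real
  assumes M: "symmetric_mat M"
  defines "f \<equiv> \<lambda>x :: real^'n. c + rodrigues 1 (x \<bullet> x) * (a \<bullet> x) + rodrigues 2 (x \<bullet> x) * (x \<bullet> (M *v x))"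
  shows "GDERIV f 0 :> a" "has_hessian f M 0"
proof -
  define G where "G x = rodrigues 1 (x \<bullet> x) *\<^sub>R a + (2 * rodrigues 2 (x \<bullet> x)) *\<^sub>R (M *v x)
      + (2 * rodrigues' 1 (x \<bullet> x) * (a \<bullet> x) + 2 * rodrigues' 2 (x \<bullet> x) * (x \<bullet> (M *v x))) *\<^sub>R x" for x
  have M': "u \<bullet> (M *v v) = (M *v u) \<bullet> v" for u v
    using M unfolding symmetric_mat_def by (metis dot_lmul_matrix transpose_matrix_vector)
  note [derivative_intros] = has_derivative_rodrigues_inner has_derivative_matrix_vector_mult
  have G: "GDERIV f x :> G x" for x
  proof -
    have "(f has_derivative (\<lambda>h. 0 + (rodrigues 1 (x \<bullet> x) * (a \<bullet> h)
        + rodrigues' 1 (x \<bullet> x) * (2 * (x \<bullet> h)) * (a \<bullet> x))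
        + (rodrigues 2 (x \<bullet> x) * (x \<bullet> (M *v h) + h \<bullet> (M *v x))
        + rodrigues' 2 (x \<bullet> x) * (2 * (x \<bullet> h)) * (x \<bullet> (M *v x))))) (at x)"
      unfolding f_def by (rule derivative_intros)+
    moreover have "0 + (rodrigues 1 (x \<bullet> x) * (a \<bullet> h)
        + rodrigues' 1 (x \<bullet> x) * (2 * (x \<bullet> h)) * (a \<bullet> x))
        + (rodrigues 2 (x \<bullet> x) * (x \<bullet> (M *v h) + h \<bullet> (M *v x))
        + rodrigues' 2 (x \<bullet> x) * (2 * (x \<bullet> h)) * (x \<bullet> (M *v x))) = h \<bullet> G x" for h
    proof -
      have "x \<bullet> (M *v h) = h \<bullet> (M *v x)"
        using M' inner_commute by metis
      then show ?thesis
        by (simp only: G_def inner_add_right inner_scaleR_right inner_commute[of a h] inner_commute[of x h])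
           (simp add: ring_distribs mult_ac)
    qed
    ultimately show ?thesis
      by (simp add: gderiv_def)
  qed
  then show "GDERIV f 0 :> a"
    using G[of 0] by (simp add: G_def)
  have rd: "\<exists>d. ((\<lambda>x::real^'n. rodrigues' m (x \<bullet> x)) has_derivative (\<lambda>h. d * (2 * (0 \<bullet> h)))) (at 0)" for m
  proof -
    obtain d where "(rodrigues' m has_real_derivative d) (at ((0::real^'n) \<bullet> 0))"
      using rodrigues'_differentiable by blast
    from has_derivative_compose[OF has_derivative_inner_self this[unfolded has_field_derivative_def]]
    show ?thesis by blast
  qed
  obtain d1 d2 where d: "((\<lambda>x::real^'n. rodrigues' 1 (x \<bullet> x)) has_derivative (\<lambda>h. d1 * (2 * (0 \<bullet> h)))) (at 0)"
    "((\<lambda>x::real^'n. rodrigues' 2 (x \<bullet> x)) has_derivative (\<lambda>h. d2 * (2 * (0 \<bullet> h)))) (at 0)"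
    using rd by meson
  have "(G has_derivative (*v) M) (at 0)"
    unfolding G_def
    by (rule derivative_eq_intros has_derivative_rodrigues_inner has_derivative_matrix_vector_mult d refl)+
       (simp add: fun_eq_iff)
  with G show "has_hessian f M 0"
    unfolding has_hessian_def by (intro exI[of _ G] conjI) simp_all
qed

lemma trace_mat: "trace (mat c :: real^'n^'n) = of_nat CARD('n) * c"
  by (simp add: trace_def mat_def)

lemma vee_hat [simp]: "vee (hat x) = x"
proof -
  have "inj hat"
    by (auto simp: inj_on_def hat_entries vec_eq_iff forall_3)
  then show ?thesis by (simp add: vee_def)
qed

lemma vee_skew:
  assumes "transpose A = - A"
  shows "vee A = vector [A$3$2, A$1$3, A$2$1]"
proof -
  have "A$j$i = - (A$i$j)" for i j
    using arg_cong[OF assms, of "\<lambda>B. B$i$j"] by (simp add: transpose_def)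
  then have "A = hat (vector [A$3$2, A$1$3, A$2$1])"
    unfolding hat_entries vec_eq_iff forall_3
    by (metis (no_types, opaque_lifting) vector_3 add.inverse_inverse equal_neg_zero)
  then show ?thesis by (metis vee_hat)
qed

lemma rot_coord_differentiable:
  assumes S: "\<And>i j. i \<noteq> j \<Longrightarrow> S $ i $ j = 0"
  shows "(\<lambda>\<phi>. rot_coord U S V (R ** matrix_exp (hat \<phi>))) differentiable at x"
proof -
  define W :: "real^3^3 \<Rightarrow> real^3^3" where
    "W X = (transpose U ** (R ** X) ** V) ** S - S ** transpose (transpose U ** (R ** X) ** V)" for X
  define L :: "real^3^3 \<Rightarrow> real^3" where "L A = vector [A$3$2, A$1$3, A$2$1]" for A
  have "transpose S = S"
    using S by (simp add: transpose_def vec_eq_iff) (metis)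
  then have "transpose (W X) = - W X" for X
    by (simp add: W_def matrix_transpose_mul)
       (simp add: vec_eq_iff transpose_def matrix_matrix_mult_def mult.commute)
  then have eq: "rot_coord U S V (R ** X) = L (W X)" for X
    unfolding rot_coord_def Let_def L_def W_def[symmetric] by (rule vee_skew)
  have L: "linear L"
    by (rule linearI) (simp_all add: L_def vec_eq_iff forall_3)
  have 1: "linear (\<lambda>X. transpose U ** (R ** X) ** V)"
    using linear_compose[OF linear_compose[OF linear_matrix_mult_left[of R]
          linear_matrix_mult_left[of "transpose U"]]
        linear_matrix_mult_right[of V]] by (simp add: o_def)
  have "linear W"
    unfolding W_def
    using linear_compose_sub[OF linear_compose[OF 1 linear_matrix_mult_right[of S]]
        linear_compose[OF linear_compose[OF 1 linear_transpose] linear_matrix_mult_left[of S]]] by (simp add: o_def)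
  then have "linear (\<lambda>X. L (W X))"
    using linear_compose[OF _ L, of W] by (simp add: o_def)
  then have "(\<lambda>X. L (W X)) differentiable at y" for y
    using linear_imp_differentiable by blast
  from differentiable_chain_at[OF matrix_exp_hat_differentiable this]
  show ?thesis unfolding eq by (simp add: o_def)
qed

lemma
  assumes "invertible A"
  shows matrix_inv_right: "A ** matrix_inv A = mat 1"
    and matrix_inv_left: "matrix_inv A ** A = mat 1"
  using someI_ex[OF assms[unfolded invertible_def]] unfolding matrix_inv_def by blast+

lemma pos_def_invertible:
  assumes "pos_def A" shows "invertible A"
proof -
  have "inj ((*v) A)"
    using assms unfolding pos_def_def
    by (metis inner_zero_right less_irrefl linear_injective_0 matrix_vector_mul_linear)
  then show ?thesis
    using invertible_left_inverse matrix_left_invertible_injective by blast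
qed

lemma rot_part_matrix: "rot_part x = matrix rot_part *v x"
proof -
  have "linear rot_part"
    by (rule linearI) (simp_all add: rot_part_def vec_eq_iff)
  then show ?thesis by (simp add: linear_conv_bounded_linear fun_eq_iff)
qed

lemma trans_part_matrix: "trans_part x = matrix trans_part *v x"
proof -
  have "linear trans_part"
    by (rule linearI) (simp_all add: trans_part_def vec_eq_iff)
  then show ?thesis by (simp add: linear_conv_bounded_linear fun_eq_iff)
qed

lemma vec_Plus_decomp:
  "x = transpose (matrix rot_part) *v rot_part x + transpose (matrix trans_part) *v trans_part x"
proof -
  have "x $ i = (transpose (matrix rot_part) *v rot_part x + transpose (matrix trans_part) *v trans_part x) $ i" for i
    by (cases i) (simp_all add: matrix_vector_mult_def transpose_def matrix_def rot_part_def
        trans_part_def axis_def if_distrib if_distribR cong: if_cong)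
  then show ?thesis by (simp add: vec_eq_iff)
qed

lemma sum_UNIV_Plus:
  "sum f (UNIV :: ('a::finite + 'b::finite) set) = (\<Sum>i\<in>UNIV. f (Inl i)) + (\<Sum>i\<in>UNIV. f (Inr i))"
  by (simp add: UNIV_Plus_UNIV[symmetric] sum.Plus o_def del: UNIV_Plus_UNIV)

lemma rot_part_mult:
  "rot_part (A *v x) = block Inl Inl A *v rot_part x + block Inl Inr A *v trans_part x"
  by (simp add: rot_part_def trans_part_def block_def matrix_vector_mult_def vec_eq_iff sum_UNIV_Plus)

lemma trans_part_mult:
  "trans_part (A *v x) = block Inr Inl A *v rot_part x + block Inr Inr A *v trans_part x"
  by (simp add: rot_part_def trans_part_def block_def matrix_vector_mult_def vec_eq_iff sum_UNIV_Plus)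

theorem theorem4p3:
  fixes R\<^sub>B :: "real^3^3" and p\<^sub>B :: "real^3"
    and J_MAP :: "pose \<Rightarrow> real"
    and g :: "real^(3 + 3)" and H :: "real^(3 + 3)^(3 + 3)"
    and g\<^sub>\<phi> g\<^sub>v a_post \<mu>_post \<nu>_post :: "real^3"
    and H\<^sub>\<phi>\<^sub>\<phi> H\<^sub>\<phi>\<^sub>v H\<^sub>v\<^sub>\<phi> H\<^sub>v\<^sub>v :: "real^3^3"
    and \<Lambda>_post M_post C_post F_post U_post S_post V_post J_\<nu>_post \<Gamma>_post :: "real^3^3"
  assumes R\<^sub>B: "rotation_matrix R\<^sub>B"
    and model: "\<forall>\<^sub>F \<xi> in nhds 0.
      J_MAP ((R\<^sub>B, p\<^sub>B) \<boxplus> \<xi>) = J_MAP (R\<^sub>B, p\<^sub>B) + g \<bullet> \<xi> + (1/2) * (\<xi> \<bullet> (H *v \<xi>))"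
    and H_sym: "symmetric_mat H"
    and g_blocks: "g\<^sub>\<phi> = rot_part g" "g\<^sub>v = trans_part g"
    and H_blocks: "H\<^sub>\<phi>\<^sub>\<phi> = block Inl Inl H" "H\<^sub>\<phi>\<^sub>v = block Inl Inr H"
      "H\<^sub>v\<^sub>\<phi> = block Inr Inl H" "H\<^sub>v\<^sub>v = block Inr Inr H"
    and Hvv_pos: "pos_def H\<^sub>v\<^sub>v"
    and \<Lambda>_post: "\<Lambda>_post = H\<^sub>v\<^sub>v"
    and a_post: "a_post = g\<^sub>\<phi> - H\<^sub>\<phi>\<^sub>v *v (matrix_inv H\<^sub>v\<^sub>v *v g\<^sub>v)"
    and M_post: "M_post = H\<^sub>\<phi>\<^sub>\<phi> - H\<^sub>\<phi>\<^sub>v ** matrix_inv H\<^sub>v\<^sub>v ** H\<^sub>v\<^sub>\<phi>"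
    and C_post: "C_post = mat (trace M_post / 2) - M_post"
    and F_post: "F_post = R\<^sub>B ** (C_post - (1/2) *\<^sub>R hat a_post)"
    and svd_post: "proper_svd F_post U_post S_post V_post"
    and \<nu>_post: "\<nu>_post = rot_coord U_post S_post V_post R\<^sub>B"
    and J_\<nu>_post: "J_\<nu>_post = rot_coord_jacobian U_post S_post V_post R\<^sub>B"
    and M_psd: "pos_semidef M_post"
    and J_nonsingular: "invertible J_\<nu>_post"
    and chart: "rotation_angle (transpose R\<^sub>B ** U_post ** transpose V_post) < pi"
    and \<Gamma>_post: "\<Gamma>_post = - (matrix_inv H\<^sub>v\<^sub>v ** H\<^sub>v\<^sub>\<phi> ** matrix_inv J_\<nu>_post)"
    and \<mu>_post: "\<mu>_post = p\<^sub>B - matrix_inv H\<^sub>v\<^sub>v *v g\<^sub>v - \<Gamma>_post *v \<nu>_post"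
  shows
    "(symmetric_mat C_post \<and> mat (trace C_post) - C_post = M_post \<and>
      (\<forall>C. symmetric_mat C \<and> mat (trace C) - C = M_post \<longrightarrow> C = C_post)) \<and>
     (GDERIV (\<lambda>\<phi>. fisher_energy F_post (R\<^sub>B ** matrix_exp (hat \<phi>))) 0 :> a_post \<and>
      has_hessian (\<lambda>\<phi>. fisher_energy F_post (R\<^sub>B ** matrix_exp (hat \<phi>))) M_post 0) \<and>
     (let \<Theta>_post = \<lparr>mfg_F = F_post, mfg_U = U_post, mfg_S = S_post, mfg_V = V_post,
                     mfg_mu = \<mu>_post, mfg_Lambda = \<Lambda>_post, mfg_Gamma = \<Gamma>_post\<rparr>
      in mfg_valid \<Theta>_post \<and>
         local_first_order \<Theta>_post (R\<^sub>B, p\<^sub>B) g \<and>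
         local_second_order_GN \<Theta>_post (R\<^sub>B, p\<^sub>B) H)"

proof -
  define \<Theta> where "\<Theta> = \<lparr>mfg_F = F_post, mfg_U = U_post, mfg_S = S_post, mfg_V = V_post,
                     mfg_mu = \<mu>_post, mfg_Lambda = \<Lambda>_post, mfg_Gamma = \<Gamma>_post\<rparr>"
  define P where "P = matrix rot_part"
  define T where "T = matrix trans_part"
  define W where "W = matrix_inv H\<^sub>v\<^sub>v"
  define B where "B = T + W ** H\<^sub>v\<^sub>\<phi> ** P"
  let ?E = "\<lambda>\<phi>. fisher_energy F_post (R\<^sub>B ** matrix_exp (hat \<phi>))"
  have P: "rot_part \<xi> = P *v \<xi>" and T: "trans_part \<xi> = T *v \<xi>" for \<xi>
    by (simp_all add: P_def T_def rot_part_matrix[symmetric] trans_part_matrix[symmetric])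
  have decomp: "\<xi> = transpose P *v rot_part \<xi> + transpose T *v trans_part \<xi>" for \<xi>
    unfolding P_def T_def by (rule vec_Plus_decomp)
  have orth: "orthogonal_matrix R\<^sub>B"
    using R\<^sub>B by (simp add: rotation_matrix_def)
  have Hvv: "symmetric_mat H\<^sub>v\<^sub>v" "H\<^sub>v\<^sub>v ** W = mat 1" "W ** H\<^sub>v\<^sub>v = mat 1"
    using Hvv_pos pos_def_invertible[OF Hvv_pos] by (simp_all add: pos_def_def W_def matrix_inv_left matrix_inv_right)
  have HW: "H\<^sub>v\<^sub>v *v (W *v u) = u" for u
    by (simp add: matrix_vector_mul_assoc Hvv)
  have W_sym: "transpose W = W"
  proof -
    have "transpose W ** H\<^sub>v\<^sub>v = mat 1"
      using arg_cong[OF Hvv(2), of transpose] Hvv(1)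
      by (simp add: matrix_transpose_mul symmetric_mat_def)
    then have "transpose W ** (H\<^sub>v\<^sub>v ** W) = W"
      by (simp add: matrix_mul_assoc)
    then show ?thesis by (simp add: Hvv(2))
  qed
  have Hpv: "transpose H\<^sub>v\<^sub>\<phi> = H\<^sub>\<phi>\<^sub>v"
    using H_sym unfolding H_blocks symmetric_mat_def block_def transpose_def
    by (simp add: vec_eq_iff)

  have M_sym: "symmetric_mat M_post"
    using M_psd by (simp add: pos_semidef_def)
  then have C_sym: "symmetric_mat C_post"
    by (simp add: C_post symmetric_mat_def transpose_def vec_eq_iff mat_def)
  have C_M: "mat (trace C_post) - C_post = M_post"
    by (simp add: C_post trace_sub trace_mat)
  have C_unique: "C = C_post" if "mat (trace C) - C = M_post" for C
  proof -
    have "trace M_post = 2 * trace C"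
      using arg_cong[OF that, of trace] by (simp add: trace_sub trace_mat)
    then show ?thesis
      using that by (auto simp: C_post)
  qed
  have fisher: "GDERIV ?E 0 :> a_post" "has_hessian ?E M_post 0"
    using rodrigues_quadratic_expansion[OF M_sym]
    by (simp_all only: fisher_energy_rodrigues[OF orth C_sym F_post] C_M)

  have \<Gamma>J: "\<Gamma>_post ** J_\<nu>_post = - (W ** H\<^sub>v\<^sub>\<phi>)"
  proof -
    have "\<Gamma>_post ** J_\<nu>_post = - (W ** H\<^sub>v\<^sub>\<phi> ** matrix_inv J_\<nu>_post ** J_\<nu>_post)"
      unfolding \<Gamma>_post W_def by (rule linear_neg[OF linear_matrix_mult_right])
    also have "\<dots> = - (W ** H\<^sub>v\<^sub>\<phi> ** (matrix_inv J_\<nu>_post ** J_\<nu>_post))"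
      by (simp only: matrix_mul_assoc)
    finally show ?thesis
      using J_nonsingular by (simp add: matrix_inv_left)
  qed
  have B: "B *v \<xi> = trans_part \<xi> - \<Gamma>_post *v (J_\<nu>_post *v rot_part \<xi>)" for \<xi>
  proof -
    have "\<Gamma>_post *v (J_\<nu>_post *v u) = - ((W ** H\<^sub>v\<^sub>\<phi>) *v u)" for u
      using matrix_vector_mult_diff_rdistrib[of 0 "W ** H\<^sub>v\<^sub>\<phi>" u]
      by (simp add: matrix_vector_mul_assoc \<Gamma>J)
    then show ?thesis
      by (simp add: B_def P T matrix_vector_mult_add_rdistrib flip: matrix_vector_mul_assoc)
  qed
  have BtH: "transpose B ** H\<^sub>v\<^sub>v = transpose T ** H\<^sub>v\<^sub>v + transpose P ** H\<^sub>\<phi>\<^sub>v"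
  proof -
    have "transpose B = transpose T + transpose P ** H\<^sub>\<phi>\<^sub>v ** W"
      by (simp add: B_def linear_add[OF linear_transpose] matrix_transpose_mul W_sym Hpv matrix_mul_assoc)
    moreover have "transpose P ** H\<^sub>\<phi>\<^sub>v ** W ** H\<^sub>v\<^sub>v = transpose P ** H\<^sub>\<phi>\<^sub>v"
      by (simp add: matrix_mul_assoc[symmetric] Hvv)
    ultimately show ?thesis by (simp add: linear_add[OF linear_matrix_mult_right])
  qed

  have nu: "((\<lambda>\<phi>. rot_coord U_post S_post V_post (R\<^sub>B ** matrix_exp (hat \<phi>)))
      has_derivative (*v) J_\<nu>_post) (at 0)"
    using rot_coord_differentiable[of S_post U_post V_post R\<^sub>B 0] svd_post
    unfolding J_\<nu>_post rot_coord_jacobian_def jacobian_works proper_svd_def by blast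

  define r where "r \<xi> = snd ((R\<^sub>B, p\<^sub>B) \<boxplus> \<xi>) - \<mu>_post
      - \<Gamma>_post *v rot_coord U_post S_post V_post (fst ((R\<^sub>B, p\<^sub>B) \<boxplus> \<xi>))" for \<xi>
  define q where "q \<xi> = snd ((R\<^sub>B, p\<^sub>B) \<boxplus> \<xi>) - \<mu>_post
      - \<Gamma>_post *v (\<nu>_post + J_\<nu>_post *v rot_part \<xi>)" for \<xi>
  have r0: "r 0 = W *v g\<^sub>v"
    by (simp add: r_def right_perturb_def P T matrix_exp_0 \<mu>_post \<nu>_post W_def)
  have "((\<lambda>\<xi>. rot_coord U_post S_post V_post (R\<^sub>B ** matrix_exp (hat (P *v \<xi>))))
      has_derivative (\<lambda>h. J_\<nu>_post *v (P *v h))) (at 0)"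
    by (rule has_derivative_compose[where f = "(*v) P"]) (simp_all add: has_derivative_matrix_vector_mult nu)
  then have "(r has_derivative (\<lambda>h. 0 + T *v h - 0 - \<Gamma>_post *v (J_\<nu>_post *v (P *v h)))) (at 0)"
    unfolding r_def right_perturb_def P T fst_conv snd_conv
    by (intro derivative_intros has_derivative_matrix_vector_mult
        has_derivative_compose[OF _ has_derivative_matrix_vector_mult])
  moreover have "(\<lambda>h. 0 + T *v h - 0 - \<Gamma>_post *v (J_\<nu>_post *v (P *v h))) = (*v) B"
    by (simp add: fun_eq_iff B P T)
  ultimately have "(r has_derivative (*v) B) (at 0)"
    by simp
  from gderiv_quadratic_form[OF this Hvv(1)]
  have "GDERIV (\<lambda>\<xi>. (1/2) * (r \<xi> \<bullet> (H\<^sub>v\<^sub>v *v r \<xi>))) 0 :> transpose B *v (H\<^sub>v\<^sub>v *v (W *v g\<^sub>v))"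
    unfolding r0 .
  moreover have "GDERIV (\<lambda>\<xi>. ?E (P *v \<xi>)) 0 :> transpose P *v a_post"
    by (rule gderiv_compose_matrix) (simp add: fisher(1))
  ultimately have "GDERIV (\<lambda>\<xi>. ?E (P *v \<xi>) + (1/2) * (r \<xi> \<bullet> (H\<^sub>v\<^sub>v *v r \<xi>))) 0
      :> transpose P *v a_post + transpose B *v (H\<^sub>v\<^sub>v *v (W *v g\<^sub>v))"
    by (rule GDERIV_add[rotated])
  moreover have "mfg_energy \<Theta> ((R\<^sub>B, p\<^sub>B) \<boxplus> \<xi>) = ?E (P *v \<xi>) + (1/2) * (r \<xi> \<bullet> (H\<^sub>v\<^sub>v *v r \<xi>))" for \<xi>
    by (simp add: mfg_energy_def mfg_quadratic_def mfg_nu_def \<Theta>_def r_def Let_def \<Lambda>_post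
        right_perturb_def P)
  moreover have "transpose P *v a_post + transpose B *v (H\<^sub>v\<^sub>v *v (W *v g\<^sub>v)) = g"
  proof -
    have "transpose B *v (H\<^sub>v\<^sub>v *v (W *v g\<^sub>v)) = transpose T *v (H\<^sub>v\<^sub>v *v (W *v g\<^sub>v)) + transpose P *v (H\<^sub>\<phi>\<^sub>v *v (W *v g\<^sub>v))"
      using arg_cong[OF BtH, of "\<lambda>A. A *v (W *v g\<^sub>v)"]
      by (simp only: matrix_vector_mult_add_rdistrib matrix_vector_mul_assoc[symmetric])
    then show ?thesis
      using decomp[of g, symmetric]
      by (simp add: HW a_post[folded W_def] g_blocks matrix_vector_mult_diff_distrib)
  qed
  ultimately have first: "local_first_order \<Theta> (R\<^sub>B, p\<^sub>B) g"
    by (simp add: local_first_order_def)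

  have "(q has_derivative (*v) B) (at x)" for x
  proof -
    have "(q has_derivative (\<lambda>h. 0 + T *v h - 0 - \<Gamma>_post *v (0 + J_\<nu>_post *v (P *v h)))) (at x)"
      unfolding q_def right_perturb_def P T snd_conv
      by (intro derivative_intros has_derivative_matrix_vector_mult
          has_derivative_compose[OF _ has_derivative_matrix_vector_mult])
    moreover have "(\<lambda>h. 0 + T *v h - 0 - \<Gamma>_post *v (0 + J_\<nu>_post *v (P *v h))) = (*v) B"
      by (simp add: fun_eq_iff B P T)
    ultimately show ?thesis by simp
  qed
  from has_hessian_quadratic_form[OF this Hvv(1)]
  have "has_hessian (\<lambda>\<xi>. (1/2) * (q \<xi> \<bullet> (H\<^sub>v\<^sub>v *v q \<xi>))) (transpose B ** H\<^sub>v\<^sub>v ** B) 0" .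
  moreover have "has_hessian (\<lambda>\<xi>. ?E (P *v \<xi>)) (transpose P ** M_post ** P) 0"
    by (rule has_hessian_compose_matrix) (simp add: fisher(2))
  ultimately have "has_hessian (\<lambda>\<xi>. ?E (P *v \<xi>) + (1/2) * (q \<xi> \<bullet> (H\<^sub>v\<^sub>v *v q \<xi>)))
      (transpose P ** M_post ** P + transpose B ** H\<^sub>v\<^sub>v ** B) 0"
    by (rule has_hessian_add[rotated])
  moreover have "mfg_energy_GN \<Theta> (R\<^sub>B, p\<^sub>B) = (\<lambda>\<xi>. ?E (P *v \<xi>) + (1/2) * (q \<xi> \<bullet> (H\<^sub>v\<^sub>v *v q \<xi>)))"
    by (simp add: fun_eq_iff mfg_energy_GN_def mfg_quadratic_def mfg_nu_def \<Theta>_def q_def Let_def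
        \<Lambda>_post \<nu>_post J_\<nu>_post right_perturb_def P)
  moreover have "transpose P ** M_post ** P + transpose B ** H\<^sub>v\<^sub>v ** B = H"
  proof -
    have "(transpose P ** M_post ** P + transpose B ** H\<^sub>v\<^sub>v ** B) *v h = H *v h" for h
    proof -
      have M: "M_post *v u = H\<^sub>\<phi>\<^sub>\<phi> *v u - H\<^sub>\<phi>\<^sub>v *v (W *v (H\<^sub>v\<^sub>\<phi> *v u))" for u
        by (simp add: M_post W_def matrix_vector_mult_diff_rdistrib flip: matrix_vector_mul_assoc)
      have Bh: "B *v h = trans_part h + W *v (H\<^sub>v\<^sub>\<phi> *v rot_part h)"
        by (simp add: B_def P T matrix_vector_mult_add_rdistrib flip: matrix_vector_mul_assoc)
      have HB: "H\<^sub>v\<^sub>v *v (B *v h) = H\<^sub>v\<^sub>v *v trans_part h + H\<^sub>v\<^sub>\<phi> *v rot_part h"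
        by (simp add: Bh matrix_vector_right_distrib HW)
      have "(transpose P ** M_post ** P + transpose B ** H\<^sub>v\<^sub>v ** B) *v h
          = transpose P *v (M_post *v rot_part h) + (transpose B ** H\<^sub>v\<^sub>v) *v (B *v h)"
        by (simp add: P matrix_vector_mult_add_rdistrib flip: matrix_vector_mul_assoc)
      also have "\<dots> = transpose P *v (M_post *v rot_part h + H\<^sub>\<phi>\<^sub>v *v (B *v h)) + transpose T *v (H\<^sub>v\<^sub>v *v (B *v h))"
        unfolding BtH
        by (simp add: matrix_vector_mult_add_rdistrib matrix_vector_right_distrib flip: matrix_vector_mul_assoc)
      also have "M_post *v rot_part h + H\<^sub>\<phi>\<^sub>v *v (B *v h) = rot_part (H *v h)"
        by (simp add: M Bh rot_part_mult H_blocks[symmetric] matrix_vector_right_distrib)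
      also have "H\<^sub>v\<^sub>v *v (B *v h) = trans_part (H *v h)"
        by (simp add: HB trans_part_mult H_blocks[symmetric])
      finally show ?thesis using decomp[of "H *v h"] by simp
    qed
    then show ?thesis by (simp add: matrix_eq)
  qed
  ultimately have second: "local_second_order_GN \<Theta> (R\<^sub>B, p\<^sub>B) H"
    by (simp add: local_second_order_GN_def)

  have "mfg_valid \<Theta>"
    using svd_post Hvv_pos by (simp add: mfg_valid_def \<Theta>_def \<Lambda>_post)
  with first second C_sym C_M C_unique fisher show ?thesis
    unfolding Let_def \<Theta>_def[symmetric] by blast
qed

end
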